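(* Let $n\ge 4$ be an integer, let $N=2^n$, let $F\colon\mathbb F_2^n\to\mathbb F_2^n$ be an APN function, and let $q$ be its number of nonplateaued nonzero components, i.e. $q=|\{b\in\mathbb F_2^n\setminus\{0\}: b\cdot F\text{ is not plateaued}\}|$. \begin{enumerate} \item If $n$ is odd and $q>0$, then \[ \mathcal L(F)^2\le N\bigl(1+\sqrt{q(N-1)}\bigr). \] \item If $n$ is even, then, for every real number $C$ with $1/2\le C<1$, \[ q\le\frac{4C-C^2-1}{4}\,N+1\quad\Longrightarrow\quad \mathcal L(F)\le CN. \] \end{enumerate}
   Context: A function $F\colon\mathbb F_2^n\to\mathbb F_2^n$ is almost perfect nonlinear (APN) if for every $h\in\mathbb F_2^n\setminus\{0\}$ and every $y\in\mathbb F_2^n$ the equation $F(x+h)+F(x)=y$ has at most two solutions $x\in\mathbb F_2^n$. For $b\in\mathbb F_2^n$ let $f_b=b\cdot F\colon\mathbb F_2^n\to\mathbb F_2$, where $\cdot$ is the usual dot product over $\mathbb F_2$; a nonzero component of $F$ is some $f_b$ indexed by $b\ne0$ (components are counted by their index $b$). For a Boolean function $f\colon\mathbb F_2^n\to\mathbb F_2$ the Walsh transform is $W_f(a)=\sum_{x\in\mathbb F_2^n}(-1)^{f(x)+a\cdot x}$ for $a\in\mathbb F_2^n$. The linearity of $F$ is $\mathcal L(F)=\max\{|W_{f_b}(a)| : a\in\mathbb F_2^n,\ b\in\mathbb F_2^n\setminus\{0\}\}$. A Boolean function $f$ is plateaued if there is $\lambda>0$ such that $W_f(a)\in\{0,\lambda,-\lambda\}$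 for all $a\in\mathbb F_2^n$ (affine Boolean functions are included). *)

theory Defs
  imports "HOL-Analysis.Analysis" "HOL-Library.Z2"
begin

(* F_2 is the library field bit, which has no finiteness instance of its own.  With one,
   bit ^ 'n is a finite type, so card, sum and Max over it have no junk values. *)

lemma UNIV_bit: "(UNIV :: bit set) = {0, 1}"
  by (auto intro: bit.exhaust)

instance bit :: finite
  by standard (simp add: UNIV_bit)

definition apn :: "(bit ^ 'n \<Rightarrow> bit ^ 'n) \<Rightarrow> bool" where
  "apn F \<longleftrightarrow> (\<forall>h y. h \<noteq> 0 \<longrightarrow> card {x. F (x + h) + F x = y} \<le> 2)"

definition component :: "(bit ^ 'n \<Rightarrow> bit ^ 'n) \<Rightarrow> bit ^ 'n \<Rightarrow> bit ^ 'n \<Rightarrow> bit" where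
  "component F b = (\<lambda>x. scalar_product b (F x))"

(* The addition in the exponent is in F_2; of_bit lifts its value to 0 or 1 in nat. *)
definition walsh :: "(bit ^ 'n \<Rightarrow> bit) \<Rightarrow> bit ^ 'n \<Rightarrow> real" where
  "walsh f a = (\<Sum>x\<in>UNIV. (-1) ^ of_bit (f x + scalar_product a x))"

definition linearity :: "(bit ^ 'n \<Rightarrow> bit ^ 'n) \<Rightarrow> real" where
  "linearity F = Max {\<bar>walsh (component F b) a\<bar> | a b. b \<noteq> 0}"

definition plateaued :: "(bit ^ 'n \<Rightarrow> bit) \<Rightarrow> bool" where
  "plateaued f \<longleftrightarrow> (\<exists>l>0. \<forall>a. walsh f a \<in> {0, l, - l})"

end

theory Submission
  imports Defs
begin

text \<open>
Write \<open>n\<close> for the dimension \<open>CARD('n)\<close>, here and below, and \<open>N = 2 ^ n\<close>; let \<open>W\<close> denote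
Walsh coefficients. Everything rests on one fourth moment computation: for a set \<open>S\<close> of \<open>m\<close> points, the sum of the fourth powers of the Walsh sums of all
components restricted to \<open>S\<close> is \<open>N\<^sup>2\<close> times the number of quadruples in \<open>S\<close> on which both the points and the values of \<open>F\<close>
add up to zero. For APN functions only trivial quadruples occur, so the sum is at most
\<open>N\<^sup>2 (3 m\<^sup>2 - 2 m)\<close> (lemma \<open>apn_fourth_moment\<close>).

With \<open>S\<close> the whole space, this says that the nonzero components have average kurtosis at most 2
(lemma \<open>apn_kurtosis_sum\<close>), where the kurtosis \<open>K\<close> is the sum of the \<open>W ^ 4\<close> divided by \<open>N ^ 3\<close>. The kurtosis is at
least 1, with equality only for bent functions. The kurtosis of a plateaued function is a power of two, and
for odd \<open>n\<close> an odd power, so at least 2. Hence only the \<open>q\<close> nonplateaued components can lie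
below the average, and each component satisfies \<open>K - 1 \<le> q\<close> (lemma \<open>kurtosis_component_le\<close>). On the
other hand, a single coefficient \<open>W\<close> forces \<open>(W\<^sup>2 / N - 1)\<^sup>2 \<le> (K - 1) (N - 1)\<close>, by Cauchy-Schwarz on
the other coefficients (lemma \<open>kurtosis_peak\<close>). Together they give the odd case.

In even dimension bent components spoil this argument. Suppose instead that the component with index
\<open>b\<close> has a coefficient of modulus \<open>L > C N\<close>. Then it agrees with an affine function outside a set \<open>S\<close> of only
\<open>m = (N - L) / 2 < N / 4\<close> points. For each index \<open>c\<close> the Walsh sum \<open>T\<close> over \<open>S\<close> is half the sum or
difference of a coefficient for \<open>c\<close> and one for \<open>c + b\<close>. If both of these components are plateaued,
their coefficients are multiples of \<open>sqrt N\<close>, with quotients of constant parity; equal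
parities make \<open>T\<close> a multiple of \<open>sqrt N\<close>, and opposite parities make \<open>T\<^sup>2 \<ge> N / 4\<close> everywhere, contradicting
\<open>m < N / 4\<close>. So the fourth moment for such \<open>c\<close> is at least \<open>N\<^sup>2 m\<close> (lemma
\<open>half_difference_fourth_moment\<close>), against the general lower bound \<open>N m\<^sup>2\<close>. Comparing with the upper bound
for \<open>S\<close>, the number \<open>B\<close> of indices other than \<open>0\<close> and \<open>b\<close> for which \<open>c\<close> or \<open>c + b\<close> is nonplateaued satisfies
\<open>B N \<ge> N\<^sup>2 - 2 m N - 2 m\<^sup>2\<close>. As \<open>B \<le> 2 (q - 1)\<close>, this contradicts the assumed bound on \<open>q\<close>.
The last estimate counts \<open>b\<close> among the nonplateaued indices, and the comparison divides by \<open>m\<close>; both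
need \<open>L \<noteq> N\<close>, that is, that \<open>F\<close> has no affine component (lemma \<open>apn_no_affine_component\<close>). An affine
component would force all others to be bent, which a parity argument excludes for \<open>n \<ge> 4\<close>.
\<close>

section \<open>Signs and characters\<close>

text \<open>These rewrite rules turn sums and products in \<open>bit\<close> into conditions on parities, after
which linearity of the scalar product can no longer be used.\<close>

declare add_bit_eq_xor [simp del] mult_bit_eq_and [simp del]

definition bit_sign :: "bit \<Rightarrow> real" where
  "bit_sign t = (-1) ^ of_bit t"

lemma bit_sign_0 [simp]: "bit_sign 0 = 1"
  by (simp add: bit_sign_def)

lemma bit_sign_1 [simp]: "bit_sign 1 = -1"
  by (simp add: bit_sign_def)

lemma bit_sign_add: "bit_sign (s + t) = bit_sign s * bit_sign t"
  by (cases s; cases t) simp_all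

lemma bit_sign_cases: "bit_sign t = 1 \<or> bit_sign t = -1"
  by (cases t) simp_all

lemma bit_sign_square [simp]: "bit_sign t * bit_sign t = 1"
  by (cases t) simp_all

lemma vec_add_self [simp]: "x + x = (0 :: bit ^ 'n)"
  by (simp add: vec_eq_iff)

lemma vec_add_eq_0_iff: "x + y = 0 \<longleftrightarrow> x = (y :: bit ^ 'n)"
  by (metis add.assoc add_0 add.commute vec_add_self)

lemma scalar_product_add_right:
  "scalar_product a (x + y) = scalar_product a x + scalar_product (a :: bit ^ 'n) y"
  by (simp add: scalar_product_def distrib_left sum.distrib)

lemma scalar_product_add_left:
  "scalar_product (a + b) x = scalar_product a x + scalar_product (b :: bit ^ 'n) x"
  by (simp add: scalar_product_def distrib_right sum.distrib)

lemma scalar_product_0_left [simp]: "scalar_product 0 (x :: bit ^ 'n) = 0"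
  by (simp add: scalar_product_def)

lemma scalar_product_0_right [simp]: "scalar_product (a :: bit ^ 'n) 0 = 0"
  by (simp add: scalar_product_def)

lemma scalar_product_axis: "scalar_product a (axis i 1) = (a :: bit ^ 'n) $ i"
  by (simp add: scalar_product_def axis_def if_distrib[of "\<lambda>t. a $ _ * t"] cong: if_cong)

declare CARD_vec [simp del]

lemma card_bit_vec [simp]: "CARD(bit ^ 'n) = 2 ^ CARD('n)"
proof -
  have "CARD(bit) = 2" by (simp add: UNIV_bit)
  then show ?thesis by (simp only: CARD_vec)
qed

text \<open>Translation by a vector \<open>e\<close> with \<open>e \<bullet> x = 1\<close> permutes the summands and changes the sign of each,
so the sum equals its own negative when \<open>x \<noteq> 0\<close>.\<close>

lemma sum_bit_sign_scalar_product:
  "(\<Sum>a\<in>UNIV. bit_sign (scalar_product a x)) = (if x = 0 then 2 ^ CARD('n) else 0)"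
  for x :: "bit ^ 'n"
proof (cases "x = 0")
  case True
  then show ?thesis by simp
next
  case False
  then obtain i where i: "x $ i = 1"
    by (metis bit_not_one_iff vec_eq_iff zero_index)
  let ?s = "\<Sum>a\<in>UNIV. bit_sign (scalar_product a x)"
  have e: "scalar_product (axis i 1) x = 1"
    using i by (simp add: scalar_product_def axis_def if_distrib[of "\<lambda>t. t * x $ _"] cong: if_cong)
  have "?s = (\<Sum>a\<in>UNIV. bit_sign (scalar_product (a + axis i 1) x))"
    by (rule sum.reindex_bij_witness[of _ "\<lambda>a. a + axis i 1" "\<lambda>a. a + axis i 1"])
       (simp_all add: add.assoc)
  also have "\<dots> = - ?s"
    by (simp add: scalar_product_add_left bit_sign_add e sum_negf)
  finally show ?thesis using False by simp
qed

section \<open>Moments of restricted Walsh sums\<close>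

text \<open>The even-dimensional bound needs the Walsh sum of each component over a proper subset \<open>S\<close>.
Restricting to \<open>S\<close> keeps both Parseval and the APN bound on the fourth moment, so the
two moment computations are done once, for all \<open>S\<close>.\<close>

definition restricted_walsh :: "(bit ^ 'n) set \<Rightarrow> (bit ^ 'n \<Rightarrow> bit) \<Rightarrow> bit ^ 'n \<Rightarrow> real" where
  "restricted_walsh S f a = (\<Sum>x\<in>S. bit_sign (f x + scalar_product a x))"

lemma walsh_eq_restricted_walsh: "walsh f a = restricted_walsh UNIV f a"
  by (simp add: walsh_def restricted_walsh_def bit_sign_def)

lemma restricted_walsh_parseval:
  fixes S :: "(bit ^ 'n) set"
  shows "(\<Sum>a\<in>UNIV. (restricted_walsh S f a)\<^sup>2) = 2 ^ CARD('n) * real (card S)"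
proof -
  have "(\<Sum>a\<in>UNIV. (restricted_walsh S f a)\<^sup>2)
      = (\<Sum>a\<in>UNIV. \<Sum>x\<in>S. \<Sum>y\<in>S. bit_sign (f x + f y) * bit_sign (scalar_product a (x + y)))"
    by (simp add: restricted_walsh_def power2_eq_square sum_product bit_sign_add
        scalar_product_add_right mult_ac)
  also have "\<dots> = (\<Sum>x\<in>S. \<Sum>a\<in>UNIV. \<Sum>y\<in>S. bit_sign (f x + f y) * bit_sign (scalar_product a (x + y)))"
    by (rule sum.swap)
  also have "\<dots> = (\<Sum>x\<in>S. \<Sum>y\<in>S. \<Sum>a\<in>UNIV. bit_sign (f x + f y) * bit_sign (scalar_product a (x + y)))"
    by (intro sum.cong refl sum.swap)
  also have "\<dots> = (\<Sum>x\<in>S. \<Sum>y\<in>S. if x = y then 2 ^ CARD('n) else 0)"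
    by (intro sum.cong refl)
       (simp add: sum_distrib_left[symmetric] sum_bit_sign_scalar_product vec_add_eq_0_iff)
  also have "\<dots> = 2 ^ CARD('n) * real (card S)"
    by simp
  finally show ?thesis .
qed

text \<open>If \<open>h = x + y\<close> is nonzero, then \<open>x\<close>, \<open>y\<close>, \<open>z\<close> and \<open>w = z + h\<close> all solve the same equation
\<open>F (u + h) + F u = v\<close>, which has at most two solutions.\<close>

lemma apn_vanishing_quadruple:
  assumes "apn F" "x + y + (z + w) = 0" "F x + F y + (F z + F w) = 0"
  shows "x = y \<and> z = w \<or> x = z \<and> y = w \<or> x = w \<and> y = z"
proof (cases "x = y")
  case True
  then show ?thesis using assms(2) by (simp add: vec_add_eq_0_iff)
next
  case False
  define h where "h = x + y"
  define v where "v = F x + F y"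
  have h: "h \<noteq> 0" using False by (simp add: h_def vec_add_eq_0_iff)
  have zw: "h = z + w" "v = F z + F w"
    using assms by (simp_all add: h_def v_def vec_add_eq_0_iff)
  have y: "x + h = y" by (simp add: h_def add.assoc[symmetric])
  have w: "z + h = w" by (simp add: zw add.assoc[symmetric])
  have y': "y + h = x"
    by (metis y add.assoc add.right_neutral vec_add_self)
  have "F (x + h) + F x = v" "F (y + h) + F y = v" "F (z + h) + F z = v"
    by (simp_all only: y w y') (simp_all only: v_def zw(2)[unfolded v_def] add.commute)
  then have sub: "{x, y, z} \<subseteq> {u. F (u + h) + F u = v}" by simp
  have "card {x, y, z} \<le> 2"
    using card_mono[OF finite sub] assms(1) h unfolding apn_def by (meson le_trans)
  then have "z = x \<or> z = y" using False by (auto simp: card_insert_if split: if_splits)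
  then show ?thesis using y y' w by metis
qed

text \<open>By the previous lemma such quadruples consist of two equal pairs: \<open>m\<^sup>2\<close> of them have \<open>x = y\<close> and
\<open>z = w\<close>, and each of the other two matchings adds \<open>m\<^sup>2 - m\<close> quadruples with \<open>x \<noteq> y\<close>, where
\<open>m = card S\<close>.\<close>

lemma card_apn_vanishing_quadruples:
  fixes F :: "bit ^ 'n \<Rightarrow> bit ^ 'n"
  assumes "apn F"
  shows "real (card {((x, y), (z, w)) \<in> (S \<times> S) \<times> (S \<times> S).
            x + y + (z + w) = 0 \<and> F x + F y + (F z + F w) = 0})
         \<le> 3 * (real (card S))\<^sup>2 - 2 * real (card S)"
proof -
  define m where "m = card S"
  let ?off = "S \<times> S - (\<lambda>x. (x, x)) ` S"
  let ?D1 = "(\<lambda>(x, z). ((x, x), (z, z))) ` (S \<times> S)"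
  let ?D2 = "(\<lambda>(x, y). ((x, y), (x, y))) ` ?off"
  let ?D3 = "(\<lambda>(x, y). ((x, y), (y, x))) ` ?off"
  have off: "card ?off = m * m - m"
    by (subst card_Diff_subset) (auto simp: m_def card_cartesian_product card_image inj_on_def)
  have "{((x, y), (z, w)) \<in> (S \<times> S) \<times> (S \<times> S).
            x + y + (z + w) = 0 \<and> F x + F y + (F z + F w) = 0} \<subseteq> ?D1 \<union> (?D2 \<union> ?D3)"
    (is "?Q \<subseteq> _")
  proof
    fix p assume p: "p \<in> ?Q"
    obtain x y z w where [simp]: "p = ((x, y), (z, w))" by (metis prod.collapse)
    have "x \<in> S" "y \<in> S" "z \<in> S" "w \<in> S"
      "x = y \<and> z = w \<or> x = z \<and> y = w \<or> x = w \<and> y = z"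
      using p apn_vanishing_quadruple[OF assms] by auto
    then show "p \<in> ?D1 \<union> (?D2 \<union> ?D3)" by (cases "x = y") force+
  qed
  then have "card ?Q \<le> card (?D1 \<union> (?D2 \<union> ?D3))" by (intro card_mono) auto
  also have "\<dots> \<le> card ?D1 + (card ?D2 + card ?D3)"
    by (meson add_left_mono card_Un_le le_trans)
  also have "\<dots> \<le> card (S \<times> S) + (card ?off + card ?off)"
    by (intro add_mono card_image_le) auto
  also have "\<dots> = m * m + (m * m - m + (m * m - m))"
    by (simp add: off card_cartesian_product m_def)
  finally have "real (card ?Q) \<le> real (m * m + (m * m - m + (m * m - m)))"
    by (simp only: of_nat_le_iff)
  also have "\<dots> = 3 * (real m)\<^sup>2 - 2 * real m"
    by (simp add: of_nat_diff power2_eq_square del: add_diff_assoc add_diff_assoc2)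
  finally show ?thesis by (simp add: m_def)
qed

text \<open>Expanding the fourth power and summing over \<open>a\<close> and \<open>c\<close> leaves, by orthogonality of
characters, exactly the quadruples from \<open>S\<close> on which both the sum of the arguments and the sum of the values
vanish.\<close>

lemma apn_fourth_moment:
  fixes F :: "bit ^ 'n \<Rightarrow> bit ^ 'n"
  assumes "apn F"
  shows "(\<Sum>c\<in>UNIV. \<Sum>a\<in>UNIV. (restricted_walsh S (component F c) a) ^ 4)
         \<le> (2 ^ CARD('n))\<^sup>2 * (3 * (real (card S))\<^sup>2 - 2 * real (card S))"
proof -
  let ?P = "(S \<times> S) \<times> (S \<times> S)"
  let ?s = "\<lambda>((x, y), (z, w)). x + y + (z + w)"
  let ?t = "\<lambda>((x, y), (z, w)). F x + F y + (F z + F w)"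
  let ?N = "2 ^ CARD('n) :: real"
  have expand: "(restricted_walsh S (component F c) a) ^ 4
      = (\<Sum>p\<in>?P. bit_sign (scalar_product c (?t p)) * bit_sign (scalar_product a (?s p)))" for c a
  proof -
    let ?g = "\<lambda>x. bit_sign (component F c x + scalar_product a x)"
    have "(restricted_walsh S (component F c) a) ^ 4 = ((\<Sum>x\<in>S. ?g x) * (\<Sum>x\<in>S. ?g x)) * ((\<Sum>x\<in>S. ?g x) * (\<Sum>x\<in>S. ?g x))"
      by (simp add: restricted_walsh_def power4_eq_xxxx mult.assoc)
    also have "\<dots> = (\<Sum>((x, y), (z, w))\<in>?P. ?g x * ?g y * (?g z * ?g w))"
      by (simp only: sum_product sum.cartesian_product) (simp add: case_prod_unfold)
    also have "\<dots> = (\<Sum>p\<in>?P. bit_sign (scalar_product c (?t p)) * bit_sign (scalar_product a (?s p)))"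
      by (intro sum.cong refl)
         (simp only: case_prod_unfold component_def bit_sign_add scalar_product_add_right mult_ac)
    finally show ?thesis .
  qed
  have "(\<Sum>c\<in>UNIV. \<Sum>a\<in>UNIV. (restricted_walsh S (component F c) a) ^ 4)
      = (\<Sum>c\<in>UNIV. \<Sum>p\<in>?P. \<Sum>a\<in>UNIV. bit_sign (scalar_product c (?t p)) * bit_sign (scalar_product a (?s p)))"
    unfolding expand by (intro sum.cong refl sum.swap)
  also have "\<dots> = (\<Sum>p\<in>?P. \<Sum>c\<in>UNIV. \<Sum>a\<in>UNIV. bit_sign (scalar_product c (?t p)) * bit_sign (scalar_product a (?s p)))"
    by (rule sum.swap)
  also have "\<dots> = (\<Sum>p\<in>?P. (\<Sum>c\<in>UNIV. bit_sign (scalar_product c (?t p))) * (\<Sum>a\<in>UNIV. bit_sign (scalar_product a (?s p))))"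
    by (simp only: sum_product)
  also have "\<dots> = (\<Sum>p\<in>?P. if ?s p = 0 \<and> ?t p = 0 then ?N\<^sup>2 else 0)"
    unfolding sum_bit_sign_scalar_product by (intro sum.cong refl) (simp add: power2_eq_square)
  also have "\<dots> = ?N\<^sup>2 * real (card {p \<in> ?P. ?s p = 0 \<and> ?t p = 0})"
    by (simp add: sum.If_cases Int_def)
  also have "\<dots> \<le> ?N\<^sup>2 * (3 * (real (card S))\<^sup>2 - 2 * real (card S))"
  proof (rule mult_left_mono)
    have "{p \<in> ?P. ?s p = 0 \<and> ?t p = 0} = {((x, y), (z, w)) \<in> ?P.
            x + y + (z + w) = 0 \<and> F x + F y + (F z + F w) = 0}"
      by auto
    then show "real (card {p \<in> ?P. ?s p = 0 \<and> ?t p = 0}) \<le> 3 * (real (card S))\<^sup>2 - 2 * real (card S)"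
      using card_apn_vanishing_quadruples[OF assms, of S] by (simp only:)
  qed simp
  finally show ?thesis .
qed

section \<open>Plateaued functions\<close>

lemma restricted_walsh_Ints: "restricted_walsh S f a \<in> \<int>"
  unfolding restricted_walsh_def
  by (intro Ints_sum) (metis Ints_1 Ints_minus bit_sign_cases)

lemma walsh_parseval:
  "(\<Sum>a\<in>UNIV. (walsh (f :: bit ^ 'n \<Rightarrow> bit) a)\<^sup>2) = (2 ^ CARD('n))\<^sup>2"
  using restricted_walsh_parseval[of UNIV f]
  by (simp add: walsh_eq_restricted_walsh power2_eq_square)

text \<open>The amplitude is an integer because it is the absolute value of a Walsh coefficient, and by Parseval
its square divides \<open>2 ^ (2 * n)\<close>; so it is a power of two. At most \<open>2 ^ n\<close>
coefficients share the total \<open>2 ^ (2 * n)\<close>, hence its square is at least \<open>2 ^ n\<close>.\<close>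

lemma plateaued_power_of_two:
  fixes f :: "bit ^ 'n \<Rightarrow> bit"
  assumes "plateaued f"
  obtains j where "\<And>a. walsh f a \<in> {0, 2 ^ j, - (2 ^ j)}" "CARD('n) \<le> 2 * j"
    "(\<Sum>a\<in>UNIV. (walsh f a) ^ 4) = 2 ^ (2 * j) * (2 ^ CARD('n))\<^sup>2"
proof -
  let ?N = "2 ^ CARD('n) :: real"
  obtain l where l: "l > 0" "\<And>a. walsh f a \<in> {0, l, - l}"
    using assms by (auto simp: plateaued_def)
  define Z where "Z = {a. walsh f a \<noteq> 0}"
  have sq: "(walsh f a)\<^sup>2 = (if a \<in> Z then l\<^sup>2 else 0)" for a
    using l(2)[of a] by (auto simp: Z_def)
  have tot: "l\<^sup>2 * real (card Z) = ?N\<^sup>2"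
    using walsh_parseval[of f] by (simp add: sq sum.If_cases mult.commute)
  then have "card Z \<noteq> 0" by (intro notI) simp
  then obtain a where "a \<in> Z" by fastforce
  then have "\<bar>walsh f a\<bar> = l" using l(1) l(2)[of a] by (auto simp: Z_def)
  moreover have "\<bar>walsh f a\<bar> \<in> \<int>"
    by (simp add: walsh_eq_restricted_walsh restricted_walsh_Ints Ints_abs)
  ultimately have "l \<in> \<nat>" using l(1) by (simp add: Nats_altdef2)
  then obtain k where k: "l = real k" by (auto elim: Nats_cases)
  have "real (k\<^sup>2 * card Z) = real (2 ^ (2 * CARD('n)))"
    using tot by (simp add: k power_mult [symmetric] mult.commute)
  then have "k\<^sup>2 * card Z = 2 ^ (2 * CARD('n))" by (simp only: of_nat_eq_iff)
  then have "k dvd 2 ^ (2 * CARD('n))" by (metis dvd_triv_left dvd_mult2 power2_eq_square)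
  then obtain j where j: "k = 2 ^ j"
    using divides_primepow_nat[OF two_is_prime_nat] by auto
  have lj: "l = 2 ^ j" by (simp add: k j)
  have "?N * ?N = l\<^sup>2 * real (card Z)" using tot by (simp add: power2_eq_square)
  also have "card Z \<le> CARD(bit ^ 'n)" by (intro card_mono) auto
  then have "real (card Z) \<le> ?N" unfolding card_bit_vec
    by (metis of_nat_le_iff of_nat_numeral of_nat_power)
  then have "l\<^sup>2 * real (card Z) \<le> l\<^sup>2 * ?N" by (intro mult_left_mono) auto
  finally have "?N \<le> l\<^sup>2" by simp
  then have "(2::real) ^ CARD('n) \<le> 2 ^ (2 * j)" by (simp add: lj power_mult mult.commute)
  then have nj: "CARD('n) \<le> 2 * j" by (subst (asm) power_increasing_iff) simp_all
  have "(walsh f a) ^ 4 = l\<^sup>2 * (walsh f a)\<^sup>2" for a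
    using l(2)[of a] by (auto simp: power4_eq_xxxx power2_eq_square)
  then have "(\<Sum>a\<in>UNIV. (walsh f a) ^ 4) = l\<^sup>2 * ?N\<^sup>2"
    by (simp add: sum_distrib_left[symmetric] walsh_parseval)
  then show ?thesis using that[of j] l(2) nj by (simp add: lj power_mult mult.commute)
qed

section \<open>Kurtosis of components\<close>

text \<open>Cauchy-Schwarz on the entries other than \<open>u i\<close>: if one entry is far from the mean, then the sum of
squares exceeds its minimum. With \<open>k\<close> entries, the right-hand factor in brackets is \<open>k\<^sup>2\<close> times the variance.\<close>

lemma sum_squares_ge_peak:
  fixes u :: "'a \<Rightarrow> real"
  assumes "finite A" "i \<in> A"
  shows "(sum u A - real (card A) * u i)\<^sup>2 \<le> (real (card A) * (\<Sum>j\<in>A. (u j)\<^sup>2) - (sum u A)\<^sup>2) * (real (card A) - 1)"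
proof -
  define k where "k = real (card A) - 1"
  define s where "s = sum u (A - {i})"
  define t where "t = (\<Sum>j\<in>A - {i}. (u j)\<^sup>2)"
  have ge1: "card A \<ge> 1" using assms card_0_eq by fastforce
  have k: "real (card (A - {i})) = k"
    using assms ge1 by (simp add: k_def of_nat_diff)
  have tot: "sum u A = u i + s" "(\<Sum>j\<in>A. (u j)\<^sup>2) = (u i)\<^sup>2 + t"
    using assms by (simp_all add: s_def t_def sum.remove)
  have "s\<^sup>2 \<le> t * k"
    unfolding s_def t_def k[symmetric] by (rule sum_squared_le_sum_of_squares)
  moreover have "k \<ge> 0" using k by (metis of_nat_0_le_iff)
  ultimately have "(k + 1) * s\<^sup>2 \<le> (k + 1) * (t * k)" by (intro mult_left_mono) auto
  moreover have card: "real (card A) = k + 1" by (simp add: k_def)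
  ultimately show ?thesis
    unfolding tot card by (simp add: power2_eq_square algebra_simps)
qed

text \<open>The squared Walsh coefficients have mean \<open>2 ^ n\<close> by Parseval; the excess of the fourth moment over
\<open>(2 ^ n) ^ 3\<close> is the sum of their squared deviations from this mean.\<close>

lemma walsh_fourth_moment_ge:
  fixes f :: "bit ^ 'n \<Rightarrow> bit"
  shows "(2 ^ CARD('n)) ^ 3 \<le> (\<Sum>a\<in>UNIV. (walsh f a) ^ 4)"
    and "(\<Sum>a\<in>UNIV. (walsh f a) ^ 4) = (2 ^ CARD('n)) ^ 3 \<Longrightarrow> (walsh f a)\<^sup>2 = 2 ^ CARD('n)"
proof -
  let ?N = "2 ^ CARD('n) :: real"
  have "(\<Sum>a\<in>UNIV. ((walsh f a)\<^sup>2 - ?N)\<^sup>2)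
      = (\<Sum>a\<in>UNIV. (walsh f a) ^ 4 + (?N\<^sup>2 - 2 * ?N * (walsh f a)\<^sup>2))"
    by (intro sum.cong refl) (simp add: power4_eq_xxxx power2_eq_square algebra_simps)
  also have "\<dots> = (\<Sum>a\<in>UNIV. (walsh f a) ^ 4) + (?N * ?N\<^sup>2 - 2 * ?N * ?N\<^sup>2)"
    by (simp only: sum.distrib sum_subtractf sum_distrib_left[symmetric] walsh_parseval
        sum_constant card_bit_vec of_nat_power of_nat_numeral)
  finally have var: "(\<Sum>a\<in>UNIV. ((walsh f a)\<^sup>2 - ?N)\<^sup>2) = (\<Sum>a\<in>UNIV. (walsh f a) ^ 4) - ?N ^ 3"
    by (simp add: power2_eq_square power3_eq_cube)
  have "(\<Sum>a\<in>UNIV. ((walsh f a)\<^sup>2 - ?N)\<^sup>2) \<ge> 0" by (intro sum_nonneg) simp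
  then show "?N ^ 3 \<le> (\<Sum>a\<in>UNIV. (walsh f a) ^ 4)" by (simp add: var)
  assume "(\<Sum>a\<in>UNIV. (walsh f a) ^ 4) = ?N ^ 3"
  then have "(\<Sum>a\<in>UNIV. ((walsh f a)\<^sup>2 - ?N)\<^sup>2) = 0" by (simp add: var)
  then have "((walsh f a)\<^sup>2 - ?N)\<^sup>2 = 0"
    using sum_nonneg_eq_0_iff[of UNIV "\<lambda>a. ((walsh f a)\<^sup>2 - ?N)\<^sup>2"] by simp
  then show "(walsh f a)\<^sup>2 = ?N" by simp
qed


text \<open>The mean fourth power of the Walsh coefficients over the square of their mean square, the latter being
\<open>2 ^ n\<close> by Parseval. It is 1 exactly for functions all of whose coefficients have modulus
\<open>2 ^ (n / 2)\<close>, the bent functions.\<close>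

definition kurtosis :: "(bit ^ 'n \<Rightarrow> bit) \<Rightarrow> real" where
  "kurtosis f = (\<Sum>a\<in>UNIV. (walsh f a) ^ 4) / (2 ^ CARD('n)) ^ 3"

lemma kurtosis_ge_1: "1 \<le> kurtosis f"
  by (simp add: kurtosis_def walsh_fourth_moment_ge(1))

lemma kurtosis_eq_1_imp_bent:
  fixes f :: "bit ^ 'n \<Rightarrow> bit"
  assumes "kurtosis f = 1"
  shows "(walsh f a)\<^sup>2 = 2 ^ CARD('n)"
  using assms by (intro walsh_fourth_moment_ge(2)) (simp add: kurtosis_def)

lemma kurtosis_gt_1_if_not_plateaued:
  fixes f :: "bit ^ 'n \<Rightarrow> bit"
  assumes "\<not> plateaued f"
  shows "1 < kurtosis f"
proof (rule ccontr)
  assume "\<not> 1 < kurtosis f"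
  then have "kurtosis f = 1" using kurtosis_ge_1[of f] by linarith
  then have "\<bar>walsh f a\<bar> = sqrt (2 ^ CARD('n))" for a
    using kurtosis_eq_1_imp_bent[of f a] real_sqrt_abs[of "walsh f a"] by simp
  then have "walsh f a = sqrt (2 ^ CARD('n)) \<or> walsh f a = - sqrt (2 ^ CARD('n))" for a
    by (metis abs_if minus_minus)
  then have "walsh f a \<in> {0, sqrt (2 ^ CARD('n)), - sqrt (2 ^ CARD('n))}" for a
    by blast
  then have "plateaued f" unfolding plateaued_def
    by (intro exI[of _ "sqrt (2 ^ CARD('n))"]) simp
  with assms show False by simp
qed

lemma kurtosis_plateaued:
  fixes f :: "bit ^ 'n \<Rightarrow> bit"
  assumes "plateaued f"
  obtains i where "kurtosis f = 2 ^ i" "odd CARD('n) \<Longrightarrow> odd i"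
proof -
  obtain j where j: "CARD('n) \<le> 2 * j"
    "(\<Sum>a\<in>UNIV. (walsh f a) ^ 4) = 2 ^ (2 * j) * (2 ^ CARD('n))\<^sup>2"
    using plateaued_power_of_two[OF assms] by metis
  have "(2::real) ^ (2 * j) = 2 ^ (2 * j - CARD('n)) * 2 ^ CARD('n)"
    using j(1) by (simp flip: power_add)
  then have "kurtosis f = 2 ^ (2 * j - CARD('n))"
    by (simp add: kurtosis_def j(2) power2_eq_square power3_eq_cube)
  then show ?thesis using that j(1) by simp
qed

text \<open>A large coefficient makes the spectrum far from flat: this is \<open>sum_squares_ge_peak\<close> for the squared
Walsh coefficients.\<close>

lemma kurtosis_peak:
  fixes f :: "bit ^ 'n \<Rightarrow> bit"
  shows "((walsh f a)\<^sup>2 - 2 ^ CARD('n))\<^sup>2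
    \<le> (2 ^ CARD('n))\<^sup>2 * ((kurtosis f - 1) * (2 ^ CARD('n) - 1))"
proof -
  let ?N = "2 ^ CARD('n) :: real"
  have N: "real CARD(bit ^ 'n) = ?N" by (simp only: card_bit_vec of_nat_power of_nat_numeral)
  have "(?N\<^sup>2 - ?N * (walsh f a)\<^sup>2)\<^sup>2 \<le> (?N * (\<Sum>a\<in>UNIV. ((walsh f a)\<^sup>2)\<^sup>2) - (?N\<^sup>2)\<^sup>2) * (?N - 1)"
    using sum_squares_ge_peak[of UNIV a "\<lambda>a. (walsh f a)\<^sup>2"]
    unfolding N walsh_parseval by simp
  also have "(\<Sum>a\<in>UNIV. ((walsh f a)\<^sup>2)\<^sup>2) = ?N ^ 3 * kurtosis f"
    by (simp add: kurtosis_def flip: power_mult)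
  also have "(?N\<^sup>2 - ?N * (walsh f a)\<^sup>2)\<^sup>2 = ?N\<^sup>2 * ((walsh f a)\<^sup>2 - ?N)\<^sup>2"
    by (simp add: power2_eq_square algebra_simps)
  also have "(?N * (?N ^ 3 * kurtosis f) - (?N\<^sup>2)\<^sup>2) * (?N - 1) = ?N\<^sup>2 * (?N\<^sup>2 * ((kurtosis f - 1) * (?N - 1)))"
    by (simp add: power2_eq_square power3_eq_cube algebra_simps)
  finally show ?thesis by (rule mult_left_le_imp_le) simp
qed

lemma walsh_component_0: "walsh (component F 0) a = (if a = 0 then 2 ^ CARD('n) else 0)"
  for F :: "bit ^ 'n \<Rightarrow> bit ^ 'n"
  using sum_bit_sign_scalar_product[of a]
  by (simp add: walsh_eq_restricted_walsh restricted_walsh_def component_def)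
     (simp add: scalar_product_def mult.commute)

text \<open>The zero component alone has kurtosis \<open>2 ^ n\<close>; what the fourth moment bound leaves for the
nonzero components is an average of at most 2.\<close>

lemma apn_kurtosis_sum:
  fixes F :: "bit ^ 'n \<Rightarrow> bit ^ 'n"
  assumes "apn F"
  shows "(\<Sum>c\<in>- {0}. kurtosis (component F c) - 2) \<le> 0"
proof -
  let ?N = "2 ^ CARD('n) :: real"
  have N: "real CARD(bit ^ 'n) = ?N" by (simp only: card_bit_vec of_nat_power of_nat_numeral)
  have "(\<Sum>c\<in>UNIV. kurtosis (component F c))
      = (\<Sum>c\<in>UNIV. \<Sum>a\<in>UNIV. (restricted_walsh UNIV (component F c) a) ^ 4) / ?N ^ 3"
    by (simp add: kurtosis_def walsh_eq_restricted_walsh sum_divide_distrib)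
  also have "\<dots> \<le> ?N\<^sup>2 * (3 * ?N\<^sup>2 - 2 * ?N) / ?N ^ 3"
    using apn_fourth_moment[OF assms, of UNIV] unfolding N by (intro divide_right_mono) auto
  also have "\<dots> = 3 * ?N - 2"
    by (simp add: power2_eq_square power3_eq_cube field_simps)
  finally have "(\<Sum>c\<in>UNIV. kurtosis (component F c)) \<le> 3 * ?N - 2" .
  moreover have "kurtosis (component F 0) = ?N"
  proof -
    have "(walsh (component F 0) a) ^ 4 = (if a = 0 then ?N ^ 4 else 0)" for a
      by (simp add: walsh_component_0)
    then show ?thesis by (simp add: kurtosis_def power4_eq_xxxx power3_eq_cube)
  qed
  moreover have "(\<Sum>c\<in>UNIV. kurtosis (component F c))
      = kurtosis (component F 0) + (\<Sum>c\<in>- {0}. kurtosis (component F c))"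
    unfolding Compl_eq_Diff_UNIV by (rule sum.remove) auto
  moreover have "real (card (- {0 :: bit ^ 'n})) = ?N - 1"
    unfolding N[symmetric]
    by (simp add: Compl_eq_Diff_UNIV card_Diff_singleton of_nat_diff Suc_le_eq)
  ultimately show ?thesis by (simp add: sum_subtractf)
qed

section \<open>Linearity in odd dimension\<close>

lemma linearity_attained:
  fixes F :: "bit ^ 'n \<Rightarrow> bit ^ 'n"
  obtains a b where "b \<noteq> 0" "linearity F = \<bar>walsh (component F b) a\<bar>"
proof -
  let ?A = "{\<bar>walsh (component F b) a\<bar> | a b. b \<noteq> 0}"
  have "?A = (\<lambda>(a, b). \<bar>walsh (component F b) a\<bar>) ` (UNIV \<times> - {0})" by auto
  then have "finite ?A" by simp
  moreover have "axis undefined 1 \<noteq> (0 :: bit ^ 'n)" by (simp add: axis_eq_0_iff)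
  then have "?A \<noteq> {}" by blast
  ultimately have "linearity F \<in> ?A" unfolding linearity_def by (rule Max_in)
  then show ?thesis using that by blast
qed

text \<open>In odd dimension a plateaued component has kurtosis at least 2, so a component of kurtosis above the
average 2 can be compensated only by nonplateaued ones. Each of these falls short of 2
by less than 1. If \<open>b\<close> is itself nonplateaued, there are \<open>q - 1\<close> others, which gives the claim. If \<open>b\<close> is
plateaued, all \<open>q\<close> of them may contribute, but the strict inequality and the integrality of
the kurtosis of \<open>b\<close> recover the missing 1.\<close>

lemma kurtosis_component_le:
  fixes F :: "bit ^ 'n \<Rightarrow> bit ^ 'n"
  assumes "apn F" "odd CARD('n)" "b \<noteq> 0"
    and q: "q = card {b. b \<noteq> 0 \<and> \<not> plateaued (component F b)}" "q > 0"
  shows "kurtosis (component F b) - 1 \<le> real q"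
proof -
  let ?K = "\<lambda>c. kurtosis (component F c)"
  define Q where "Q = {b. b \<noteq> 0 \<and> \<not> plateaued (component F b)}"
  have plat: "\<exists>k::nat. k \<ge> 2 \<and> ?K c = real k" if p: "plateaued (component F c)" for c
  proof -
    obtain i where "?K c = 2 ^ i" "odd CARD('n) \<Longrightarrow> odd i"
      using kurtosis_plateaued[OF p] by blast
    with assms(2) have "?K c = 2 ^ i" "odd i" by simp_all
    then show ?thesis by (intro exI[of _ "2 ^ i"]) (auto elim: oddE)
  qed
  have gt: "?K c > 1" if "c \<in> Q" for c
    using that kurtosis_gt_1_if_not_plateaued by (auto simp: Q_def)
  have "(\<Sum>c\<in>- {0}. ?K c - 2) = ?K b - 2 + (\<Sum>c\<in>- {0} - {b}. ?K c - 2)"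
    using assms(3) by (intro sum.remove) auto
  then have "?K b - 2 + (\<Sum>c\<in>- {0} - {b}. ?K c - 2) \<le> 0"
    using apn_kurtosis_sum[OF assms(1)] by simp
  moreover have "(\<Sum>c\<in>Q - {b}. ?K c - 2) \<le> (\<Sum>c\<in>- {0} - {b}. ?K c - 2)"
  proof (rule sum_mono2)
    fix c assume "c \<in> - {0} - {b} - (Q - {b})"
    then show "0 \<le> ?K c - 2" using plat[of c] by (auto simp: Q_def)
  qed (auto simp: Q_def)
  ultimately have le: "?K b - 2 \<le> (\<Sum>c\<in>Q - {b}. 2 - ?K c)"
    by (simp add: sum_subtractf)
  show ?thesis
  proof (cases "b \<in> Q")
    case True
    have "(\<Sum>c\<in>Q - {b}. 2 - ?K c) \<le> (\<Sum>c\<in>Q - {b}. 1)"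
      using gt by (intro sum_mono) (auto simp: less_eq_real_def)
    also have "\<dots> = real q - 1"
      using True q by (simp add: Q_def[symmetric] of_nat_diff)
    finally show ?thesis using le by simp
  next
    case False
    then have "(\<Sum>c\<in>Q - {b}. 2 - ?K c) < (\<Sum>c\<in>Q - {b}. 1)"
      using gt q by (intro sum_strict_mono) (auto simp: Q_def card_gt_0_iff)
    also have "\<dots> = real q" using False q by (simp add: Q_def[symmetric])
    finally have "?K b < real q + 2" using le by simp
    moreover obtain k where k: "?K b = real k"
      using plat[of b] False assms(3) by (auto simp: Q_def)
    ultimately have "k < q + 2" by linarith
    then show ?thesis by (simp add: k)
  qed
qed

lemma linearity_bound_odd:
  fixes F :: "bit ^ 'n \<Rightarrow> bit ^ 'n"
  assumes "apn F" "odd CARD('n)"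
    and q: "q = card {b. b \<noteq> 0 \<and> \<not> plateaued (component F b)}" "q > 0"
  shows "(linearity F)\<^sup>2 \<le> 2 ^ CARD('n) * (1 + sqrt (real q * (2 ^ CARD('n) - 1)))"
proof -
  let ?N = "2 ^ CARD('n) :: real"
  obtain a b where b: "b \<noteq> 0" "linearity F = \<bar>walsh (component F b) a\<bar>"
    using linearity_attained .
  have "((linearity F)\<^sup>2 - ?N)\<^sup>2 \<le> ?N\<^sup>2 * ((kurtosis (component F b) - 1) * (?N - 1))"
    using kurtosis_peak[of "component F b" a] by (simp add: b)
  also have "\<dots> \<le> ?N\<^sup>2 * (real q * (?N - 1))"
    by (intro mult_left_mono mult_right_mono kurtosis_component_le[OF assms(1,2) b(1) q]) auto
  finally have "sqrt (((linearity F)\<^sup>2 - ?N)\<^sup>2) \<le> sqrt (?N\<^sup>2 * (real q * (?N - 1)))"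
    by (rule real_sqrt_le_mono)
  then have "\<bar>(linearity F)\<^sup>2 - ?N\<bar> \<le> ?N * sqrt (real q * (?N - 1))"
    by (simp add: real_sqrt_mult)
  then show ?thesis by (simp add: algebra_simps)
qed

section \<open>Half differences of plateaued Walsh spectra in even dimension\<close>

text \<open>Walsh coefficients of a plateaued function in dimension \<open>2 * r\<close> are \<open>0\<close> or \<open>\<plusminus> 2 ^ j\<close> with \<open>j \<ge> r\<close>. For
\<open>j = r\<close> the function is bent and all quotients by \<open>2 ^ r\<close> are \<open>\<plusminus> 1\<close>; for \<open>j > r\<close> all of them are even.\<close>

lemma walsh_quotient_constant_parity:
  fixes f :: "bit ^ 'n \<Rightarrow> bit"
  assumes "plateaued f" "CARD('n) = 2 * r"
  obtains k :: "bit ^ 'n \<Rightarrow> int" and e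
  where "\<And>a. walsh f a = 2 ^ r * of_int (k a)" "\<And>a. even (k a) \<longleftrightarrow> e"
proof -
  obtain j where j: "\<And>a. walsh f a \<in> {0, 2 ^ j, - (2 ^ j)}" "CARD('n) \<le> 2 * j"
      "(\<Sum>a\<in>UNIV. (walsh f a) ^ 4) = 2 ^ (2 * j) * (2 ^ CARD('n))\<^sup>2"
    using plateaued_power_of_two[OF assms(1)] by metis
  define k :: "bit ^ 'n \<Rightarrow> int"
    where "k a = (if walsh f a = 0 then 0 else if walsh f a > 0 then 2 ^ (j - r) else - (2 ^ (j - r)))" for a
  have rj: "r \<le> j" using j(2) assms(2) by simp
  then have split: "(2::real) ^ j = 2 ^ r * 2 ^ (j - r)" by (simp flip: power_add)
  have k: "walsh f a = 2 ^ r * of_int (k a)" for a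
    using j(1)[of a] by (auto simp: k_def split mult_less_0_iff zero_less_mult_iff)
  show ?thesis
  proof (cases "j = r")
    case True
    have "(\<Sum>a\<in>UNIV. (walsh f a) ^ 4) = (2 ^ CARD('n)) ^ 3"
      by (simp add: j(3) True assms(2) power3_eq_cube power2_eq_square)
    then have "(walsh f a)\<^sup>2 = 2 ^ CARD('n)" for a
      by (rule walsh_fourth_moment_ge(2))
    then have "walsh f a \<noteq> 0" for a
      by (metis power_not_zero zero_neq_numeral zero_power2)
    then have "odd (k a)" for a by (simp add: k_def True)
    then show ?thesis using that[of k False] k by blast
  next
    case False
    then have "even (k a)" for a using rj by (simp add: k_def)
    then show ?thesis using that[of k True] k by blast
  qed
qed

text \<open>The indicator of the set is \<open>(1 - \<epsilon> * bit_sign (g x)) / 2\<close>, and multiplying by the sign of \<open>g\<close> adds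
\<open>g\<close> to \<open>f\<close>.\<close>

lemma restricted_walsh_sign_set:
  assumes "\<epsilon> = 1 \<or> \<epsilon> = - 1"
  shows "restricted_walsh {x. bit_sign (g x) = - \<epsilon>} f a
    = (walsh f a - \<epsilon> * walsh (\<lambda>x. f x + g x) a) / 2"
proof -
  have ind: "(if bit_sign (g x) = - \<epsilon> then 1 else 0) = (1 - \<epsilon> * bit_sign (g x)) / 2" for x
    using assms bit_sign_cases[of "g x"] by auto
  have "restricted_walsh {x. bit_sign (g x) = - \<epsilon>} f a
      = (\<Sum>x\<in>UNIV. bit_sign (f x + scalar_product a x) * (if bit_sign (g x) = - \<epsilon> then 1 else 0))"
    by (simp add: restricted_walsh_def sum.If_cases if_distrib cong: if_cong)
  also have "\<dots> = (\<Sum>x\<in>UNIV. (bit_sign (f x + scalar_product a x)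
      - \<epsilon> * bit_sign (f x + g x + scalar_product a x)) / 2)"
    unfolding ind by (intro sum.cong refl) (simp add: bit_sign_add algebra_simps)
  also have "\<dots> = (walsh f a - \<epsilon> * walsh (\<lambda>x. f x + g x) a) / 2"
    by (simp add: walsh_eq_restricted_walsh restricted_walsh_def sum_subtractf
        sum_distrib_left flip: sum_divide_distrib)
  finally show ?thesis .
qed

lemma walsh_component_add:
  "walsh (\<lambda>x. component F c x + (component F b x + scalar_product d x)) a
    = walsh (component F (c + b)) (a + d)"
  by (simp add: walsh_eq_restricted_walsh restricted_walsh_def component_def
      scalar_product_add_left bit_sign_add mult_ac)

text \<open>By lemma \<open>walsh_quotient_constant_parity\<close>, \<open>2 * T a / 2 ^ r\<close> is an integer of constant parity. If it is even,
every \<open>T a\<close> is a multiple of \<open>2 ^ r\<close>, so \<open>T a\<close> is zero or its square is at least \<open>2 ^ n\<close>, and the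
claim holds term by term. If it is odd, every \<open>(T a)\<^sup>2\<close> is at least a quarter of \<open>2 ^ n\<close>, which is
too much for the assumed bound on the sum of squares.\<close>

lemma half_difference_fourth_moment:
  fixes f g :: "bit ^ 'n \<Rightarrow> bit"
  assumes "plateaued f" "plateaued g" "CARD('n) = 2 * r"
    and \<epsilon>: "\<epsilon> = 1 \<or> \<epsilon> = - 1"
    and T: "\<And>a. T a = (walsh f a - \<epsilon> * walsh g (a + d)) / 2"
    and small: "4 * (\<Sum>a\<in>UNIV. (T a)\<^sup>2) < (2 ^ CARD('n))\<^sup>2"
  shows "2 ^ CARD('n) * (\<Sum>a\<in>UNIV. (T a)\<^sup>2) \<le> (\<Sum>a\<in>UNIV. (T a) ^ 4)"
proof -
  let ?N = "2 ^ CARD('n) :: real"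
  obtain k e where k: "\<And>a. walsh f a = 2 ^ r * of_int (k a)" "\<And>a. even (k a) \<longleftrightarrow> e"
    using walsh_quotient_constant_parity[OF assms(1,3)] by blast
  obtain k' e' where k': "\<And>a. walsh g a = 2 ^ r * of_int (k' a)" "\<And>a. even (k' a) \<longleftrightarrow> e'"
    using walsh_quotient_constant_parity[OF assms(2,3)] by blast
  define u where "u a = (if \<epsilon> = 1 then k a - k' (a + d) else k a + k' (a + d))" for a
  have N: "?N = (2 ^ r)\<^sup>2" by (simp add: assms(3) power_mult mult.commute)
  have Tu: "T a = 2 ^ r * of_int (u a) / 2" for a
    using \<epsilon> by (auto simp: T k(1) k'(1) u_def algebra_simps)
  have par: "even (u a) \<longleftrightarrow> (e \<longleftrightarrow> e')" for a
    using k(2)[of a] k'(2)[of "a + d"] by (auto simp: u_def)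
  show ?thesis
  proof (cases "e \<longleftrightarrow> e'")
    case True
    have "?N * (T a)\<^sup>2 \<le> (T a) ^ 4" for a
    proof -
      obtain v where v: "u a = 2 * v" using par[of a] True by (auto elim: evenE)
      have "v = 0 \<or> 1 \<le> v\<^sup>2" by (cases "v = 0") (simp_all add: int_one_le_iff_zero_less)
      then have "v\<^sup>2 * 1 \<le> v\<^sup>2 * v\<^sup>2"
        by (elim disjE) (simp, intro mult_left_mono, auto)
      then have "real_of_int (v\<^sup>2) \<le> real_of_int (v\<^sup>2 * v\<^sup>2)" by (simp only: of_int_le_iff mult_1_right)
      then have "?N * ?N * (real_of_int v)\<^sup>2 \<le> ?N * ?N * ((real_of_int v)\<^sup>2 * (real_of_int v)\<^sup>2)"
        by (intro mult_left_mono) auto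
      then show ?thesis
        unfolding N by (simp add: Tu v power4_eq_xxxx power2_eq_square mult_ac)
    qed
    then show ?thesis by (simp add: sum_distrib_left sum_mono)
  next
    case False
    have "?N \<le> 4 * (T a)\<^sup>2" for a
    proof -
      have "u a \<noteq> 0" using par[of a] False by auto
      then have "1 \<le> (u a)\<^sup>2" by (simp add: int_one_le_iff_zero_less)
      then have "1 \<le> (real_of_int (u a))\<^sup>2" by (metis of_int_1_le_iff of_int_power)
      then have "?N * 1 \<le> ?N * (real_of_int (u a))\<^sup>2" by (intro mult_left_mono) auto
      then show ?thesis unfolding N by (simp add: Tu power2_eq_square mult_ac)
    qed
    then have "(\<Sum>a\<in>(UNIV :: (bit ^ 'n) set). ?N) \<le> (\<Sum>a\<in>UNIV. 4 * (T a)\<^sup>2)" by (intro sum_mono)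
    then show ?thesis using small by (simp add: power2_eq_square sum_distrib_left)
  qed
qed

section \<open>No affine components in even dimension\<close>

lemma sum_walsh_components_at_0:
  fixes F :: "bit ^ 'n \<Rightarrow> bit ^ 'n"
  shows "(\<Sum>c\<in>UNIV. walsh (component F c) 0 * bit_sign (scalar_product c y))
    = 2 ^ CARD('n) * real (card {x. F x = y})"
proof -
  have "(\<Sum>c\<in>UNIV. walsh (component F c) 0 * bit_sign (scalar_product c y))
      = (\<Sum>c\<in>UNIV. \<Sum>x\<in>UNIV. bit_sign (scalar_product c (F x + y)))"
    by (simp add: walsh_eq_restricted_walsh restricted_walsh_def component_def
        sum_distrib_right scalar_product_add_right bit_sign_add)
  also have "\<dots> = (\<Sum>x\<in>UNIV. \<Sum>c\<in>UNIV. bit_sign (scalar_product c (F x + y)))"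
    by (rule sum.swap)
  also have "\<dots> = 2 ^ CARD('n) * real (card {x. F x = y})"
    by (simp add: sum_bit_sign_scalar_product vec_add_eq_0_iff sum.If_cases)
  finally show ?thesis .
qed

text \<open>Summing the Walsh coefficients at 0 over the hyperplane \<open>R\<close> of all \<open>c\<close> with \<open>c $ i = 0\<close> counts
the points that \<open>F\<close> maps to 0 or to the \<open>i\<close>-th unit vector, weighted by \<open>2 ^ (n - 1)\<close>. If the coefficient were
\<open>\<plusminus> 2 ^ r\<close> for all nonzero members of \<open>R\<close>, the same sum would be \<open>2 ^ n\<close> plus \<open>2 ^ r\<close> times a sum of an odd number of signs,
which is not divisible by \<open>2 ^ (r + 1)\<close>; but \<open>2 ^ (n - 1)\<close> is, as \<open>r \<ge> 2\<close>.\<close>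

lemma not_all_bent_on_hyperplane:
  fixes F :: "bit ^ 'n \<Rightarrow> bit ^ 'n"
  assumes "CARD('n) = 2 * r" "r \<ge> 2"
    and bent: "\<And>c. c \<noteq> 0 \<Longrightarrow> c $ i = 0 \<Longrightarrow> (walsh (component F c) 0)\<^sup>2 = 2 ^ CARD('n)"
  shows False
proof -
  let ?N = "2 ^ CARD('n) :: real"
  define R where "R = {c :: bit ^ 'n. c $ i = 0}"
  define W where "W c = walsh (component F c) 0" for c
  have half: "2 * (\<Sum>c\<in>R. g c) = (\<Sum>c\<in>UNIV. g c * bit_sign (scalar_product c 0))
      + (\<Sum>c\<in>UNIV. g c * bit_sign (scalar_product c (axis i 1)))" for g :: "bit ^ 'n \<Rightarrow> real"
  proof -
    have "g c * bit_sign (scalar_product c 0) + g c * bit_sign (scalar_product c (axis i 1))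
        = (if c \<in> R then 2 * g c else 0)" for c
      by (cases "c $ i") (simp_all add: R_def scalar_product_axis)
    then show ?thesis
      by (simp add: sum.distrib[symmetric] sum.If_cases sum_distrib_left)
  qed
  have cardR: "2 * real (card R) = ?N"
    using half[of "\<lambda>_. 1"] by (simp add: sum_bit_sign_scalar_product axis_eq_0_iff)
  obtain m :: nat where m: "2 * (\<Sum>c\<in>R. W c) = ?N * real m"
    using half[of W] unfolding W_def sum_walsh_components_at_0
    by (metis distrib_left of_nat_add)
  have N: "?N = 2 ^ r * 2 ^ r" by (simp add: assms(1) mult_2 power_add)
  have "\<exists>s::int. odd s \<and> W c = 2 ^ r * of_int s" if "c \<in> R - {0}" for c
  proof -
    have "(W c)\<^sup>2 = (2 ^ r)\<^sup>2" using bent that by (simp add: W_def R_def N power2_eq_square)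
    then have "W c = 2 ^ r \<or> W c = - (2 ^ r)" by (simp add: power2_eq_iff)
    then show ?thesis by (auto intro: exI[of _ 1] exI[of _ "- 1"])
  qed
  then obtain s :: "bit ^ 'n \<Rightarrow> int"
    where s: "\<And>c. c \<in> R - {0} \<Longrightarrow> odd (s c)" "\<And>c. c \<in> R - {0} \<Longrightarrow> W c = 2 ^ r * of_int (s c)"
    by metis
  obtain t where t: "r = Suc (Suc t)" using assms(2) by (metis add_2_eq_Suc le_Suc_ex)
  have "real (card R) = real (2 * 2 ^ (2 * r - 2))"
  proof -
    have "?N = 2 * (2 * 2 ^ (2 * r - 2))"
      by (simp add: assms(1) t)
    then show ?thesis using cardR by simp
  qed
  then have evenR: "even (card R)" by (metis dvd_triv_left of_nat_eq_iff)
  have R0: "0 \<in> R" by (simp add: R_def)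
  then have "card R = Suc (card (R - {0}))" by (intro card.remove) auto
  then have "odd (card (R - {0}))" using evenR by simp
  moreover have "{c \<in> R - {0}. odd (s c)} = R - {0}" using s(1) by blast
  ultimately have odd_sum: "odd (\<Sum>c\<in>R - {0}. s c)" by (simp add: even_sum_iff)
  have "(\<Sum>c\<in>R. W c) = ?N + 2 ^ r * of_int (\<Sum>c\<in>R - {0}. s c)"
    using R0 s(2) by (simp add: sum.remove[of R 0] W_def walsh_component_0 sum_distrib_left)
  then have "2 ^ r * (2 * (2 ^ r + of_int (\<Sum>c\<in>R - {0}. s c))) = 2 ^ r * (2 ^ r * real m)"
    using m unfolding N by (simp add: algebra_simps)
  then have "2 * (2 ^ r + of_int (\<Sum>c\<in>R - {0}. s c)) = 2 ^ r * real m" by simp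
  then have "real_of_int (2 * (2 ^ r + (\<Sum>c\<in>R - {0}. s c))) = real_of_int (2 ^ r * int m)" by simp
  then have "2 * (2 ^ r + (\<Sum>c\<in>R - {0}. s c)) = 2 ^ r * int m" by (simp only: of_int_eq_iff)
  then have "(\<Sum>c\<in>R - {0}. s c) = 2 * (2 ^ t * int m - 2 * 2 ^ t)" by (simp add: t)
  with odd_sum show False by simp
qed

lemma abs_walsh_le: "\<bar>walsh f a\<bar> \<le> 2 ^ CARD('n)" for f :: "bit ^ 'n \<Rightarrow> bit"
proof -
  have "\<bar>walsh f a\<bar> \<le> (\<Sum>x\<in>(UNIV :: (bit ^ 'n) set). \<bar>bit_sign (f x + scalar_product a x)\<bar>)"
    unfolding walsh_eq_restricted_walsh restricted_walsh_def by (rule sum_abs)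
  also have "\<dots> = (\<Sum>x\<in>(UNIV :: (bit ^ 'n) set). 1)"
    by (intro sum.cong refl) (metis abs_1 abs_minus_cancel bit_sign_cases)
  finally show ?thesis by simp
qed

text \<open>An affine component has the largest possible kurtosis \<open>2 ^ n\<close> and exhausts the fourth moment:
all remaining nonzero components would have kurtosis 1, hence be bent. Those indexed by a
coordinate hyperplane avoiding \<open>b\<close> cannot all be bent.\<close>

lemma apn_no_affine_component:
  fixes F :: "bit ^ 'n \<Rightarrow> bit ^ 'n"
  assumes "apn F" "even CARD('n)" "CARD('n) \<ge> 4" "b \<noteq> 0"
  shows "\<bar>walsh (component F b) a\<bar> < 2 ^ CARD('n)"
proof (rule ccontr)
  let ?N = "2 ^ CARD('n) :: real"
  let ?K = "\<lambda>c. kurtosis (component F c)"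
  assume "\<not> \<bar>walsh (component F b) a\<bar> < ?N"
  then have "\<bar>walsh (component F b) a\<bar> = ?N" using abs_walsh_le[of "component F b" a] by linarith
  then have "(walsh (component F b) a) ^ 4 = ?N ^ 4" by (metis power_even_abs_numeral even_numeral)
  moreover have "(walsh (component F b) a) ^ 4 \<le> (\<Sum>a\<in>UNIV. (walsh (component F b) a) ^ 4)"
    by (rule member_le_sum) auto
  ultimately have "?N * ?N ^ 3 \<le> (\<Sum>a\<in>UNIV. (walsh (component F b) a) ^ 4)"
    by (simp add: power4_eq_xxxx power3_eq_cube)
  then have Kb: "?N \<le> ?K b" by (simp add: kurtosis_def pos_le_divide_eq)
  have "(\<Sum>c\<in>- {0}. ?K c - 2) = (?K b - 2) + (\<Sum>c\<in>- {0} - {b}. ?K c - 2)"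
    using assms(4) by (intro sum.remove) auto
  moreover have "(\<Sum>c\<in>- {0} - {b}. ?K c - 2) = (\<Sum>c\<in>- {0} - {b}. ?K c - 1) - real (card (- {0} - {b}))"
    by (simp add: sum_subtractf)
  moreover have "real (card (- {0} - {b})) = ?N - 2"
  proof -
    have "card {0, b} \<le> CARD(bit ^ 'n)" by (intro card_mono) auto
    moreover have "- {0} - {b} = UNIV - {0, b}" by auto
    ultimately show ?thesis using assms(4) by (simp add: card_Diff_subset of_nat_diff)
  qed
  ultimately have "(\<Sum>c\<in>- {0} - {b}. ?K c - 1) \<le> 0"
    using Kb apn_kurtosis_sum[OF assms(1)] by simp
  then have "(\<Sum>c\<in>- {0} - {b}. ?K c - 1) = 0"
    by (intro antisym sum_nonneg) (simp_all add: kurtosis_ge_1)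
  then have K1: "?K c = 1" if "c \<in> - {0} - {b}" for c
    using sum_nonneg_eq_0_iff[of "- {0} - {b}" "\<lambda>c. ?K c - 1"] that by (simp add: kurtosis_ge_1)
  obtain i where i: "b $ i \<noteq> 0" using assms(4) by (metis vec_eq_iff zero_index)
  obtain r where r: "CARD('n) = 2 * r" using assms(2) by (auto elim: evenE)
  show False
  proof (rule not_all_bent_on_hyperplane[of r i F])
    fix c :: "bit ^ 'n" assume "c \<noteq> 0" "c $ i = 0"
    then have "c \<in> - {0} - {b}" using i by auto
    then show "(walsh (component F c) 0)\<^sup>2 = ?N" by (intro kurtosis_eq_1_imp_bent K1)
  qed (use r assms(3) in auto)
qed


section \<open>Linearity in even dimension\<close>

text \<open>Suppose \<open>|W| > C N\<close> for the coefficient of \<open>component F b\<close> at \<open>d\<close>, and let \<open>S\<close> be the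
set of \<open>m = (N - |W|) / 2 < N / 4\<close> points at which this component differs from the nearest affine
function. The fourth moment of \<open>F\<close> restricted to \<open>S\<close> is at most about \<open>3 N\<^sup>2 m\<^sup>2\<close>. Every index \<open>c\<close>
contributes at least \<open>N m\<^sup>2\<close> to it, but if \<open>c\<close> and \<open>c + b\<close> are both plateaued, it
contributes at least \<open>N\<^sup>2 m\<close>, which is much more. So there are many nonplateaued components.\<close>

lemma linearity_bound_even:
  fixes F :: "bit ^ 'n \<Rightarrow> bit ^ 'n" and C :: real
  assumes "apn F" "even CARD('n)" "CARD('n) \<ge> 4"
    and C: "1 / 2 \<le> C"
    and q: "real (card {b. b \<noteq> 0 \<and> \<not> plateaued (component F b)})
      \<le> (4 * C - C\<^sup>2 - 1) / 4 * 2 ^ CARD('n) + 1"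
  shows "linearity F \<le> C * 2 ^ CARD('n)"
proof (rule ccontr)
  define N where "N = (2 ^ CARD('n) :: real)"
  define L where "L = linearity F"
  define Q where "Q = {b. b \<noteq> 0 \<and> \<not> plateaued (component F b)}"
  have N0: "N > 0" by (simp add: N_def)
  assume "\<not> linearity F \<le> C * 2 ^ CARD('n)"
  then have L: "C * N < L" by (simp add: N_def L_def)
  have "1 / 2 * N \<le> C * N" using C N0 by (intro mult_right_mono) auto
  then have half: "N / 2 < L" using L by simp
  obtain d b where b: "b \<noteq> 0" and Lb: "L = \<bar>walsh (component F b) d\<bar>"
    unfolding L_def using linearity_attained .
  have LN: "L < N"
    using apn_no_affine_component[OF assms(1-3) b] by (simp add: Lb N_def)
  \<comment> \<open>A plateaued component with a coefficient above \<open>N / 2\<close> would have amplitude \<open>N\<close>,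
    since the amplitude is a power of two.\<close>
  have bQ: "b \<in> Q"
  proof (rule ccontr)
    assume "b \<notin> Q"
    then have "plateaued (component F b)" using b by (simp add: Q_def)
    then obtain j where "walsh (component F b) d \<in> {0, 2 ^ j, - (2 ^ j)}"
      using plateaued_power_of_two by metis
    then have "L = 2 ^ j" using half N0 by (auto simp: Lb)
    then have "(2::real) ^ j < 2 ^ CARD('n)" "(2::real) ^ CARD('n) < 2 ^ Suc j"
      using LN half by (simp_all add: N_def)
    then have "j < CARD('n)" "CARD('n) < Suc j"
      by (metis one_less_numeral_iff power_strict_increasing_iff semiring_norm(76))+
    then show False by simp
  qed
  obtain \<epsilon> :: real where \<epsilon>: "\<epsilon> = 1 \<or> \<epsilon> = - 1" "\<epsilon> * walsh (component F b) d = L"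
    by (cases "walsh (component F b) d \<ge> 0") (auto simp: Lb intro: that[of 1] that[of "- 1"])
  \<comment> \<open>\<open>\<epsilon>\<close> is the sign of the large coefficient:
    the points in \<open>S\<close> are those whose summand has the minority sign.\<close>
  define S where "S = {x. bit_sign (component F b x + scalar_product d x) = - \<epsilon>}"
  define m where "m = real (card S)"
  define T where "T c a = restricted_walsh S (component F c) a" for c a
  have T: "T c a = (walsh (component F c) a - \<epsilon> * walsh (component F (c + b)) (a + d)) / 2" for c a
    unfolding T_def S_def by (simp add: restricted_walsh_sign_set[OF \<epsilon>(1)] walsh_component_add)
  have T0: "T 0 0 = m" by (simp add: T_def restricted_walsh_def component_def m_def)
  have m: "m = (N - L) / 2"
    using T[of 0 0] \<epsilon>(2) by (simp add: T0 walsh_component_0 N_def)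
  have Tb: "T b d = - \<epsilon> * m"
    by (simp add: T_def restricted_walsh_def S_def m_def)
  have parseval: "(\<Sum>a\<in>UNIV. (T c a)\<^sup>2) = N * m" for c
    by (simp add: T_def restricted_walsh_parseval N_def m_def)
  have m0: "m > 0" and m4: "4 * m < N" using LN half by (simp_all add: m)
  define M where "M c = (\<Sum>a\<in>UNIV. (T c a) ^ 4)" for c
  have peak: "(T c a) ^ 4 \<le> M c" for c a
    unfolding M_def by (rule member_le_sum) auto
  have M0: "m ^ 4 \<le> M 0" using peak[of 0 0] by (simp add: T0)
  have Mb: "m ^ 4 \<le> M b" using peak[of b d] \<epsilon>(1) by (auto simp: Tb)
  have M_all: "N * m\<^sup>2 \<le> M c" for c
  proof -
    have "(\<Sum>a\<in>UNIV. (T c a)\<^sup>2)\<^sup>2 \<le> (\<Sum>a\<in>UNIV. ((T c a)\<^sup>2)\<^sup>2) * real CARD(bit ^ 'n)"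
      by (rule sum_squared_le_sum_of_squares)
    moreover have "(\<Sum>a\<in>UNIV. ((T c a)\<^sup>2)\<^sup>2) = M c"
      by (simp add: M_def flip: power_mult)
    ultimately have "(N * m)\<^sup>2 \<le> M c * N"
      unfolding parseval by (simp add: N_def)
    then have "N * (N * m\<^sup>2) \<le> N * M c"
      by (simp add: power2_eq_square mult_ac)
    then show ?thesis using N0 by simp
  qed
  define U where "U = UNIV - {0, b}"
  \<comment> \<open>Indices \<open>c\<close> for which the strong lower bound holds;
    each index outside \<open>G\<close> has \<open>c\<close> or \<open>c + b\<close> among the nonplateaued ones other than \<open>b\<close>.\<close>
  define G where "G = {c \<in> U. plateaued (component F c) \<and> plateaued (component F (c + b))}"
  have M_good: "N\<^sup>2 * m \<le> M c" if "c \<in> G" for c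
  proof -
    obtain r where r: "CARD('n) = 2 * r" using assms(2) by (auto elim: evenE)
    have "2 ^ CARD('n) * (\<Sum>a\<in>UNIV. (T c a)\<^sup>2) \<le> M c"
      unfolding M_def
    proof (rule half_difference_fourth_moment[OF _ _ r \<epsilon>(1) T])
      show "plateaued (component F c)" "plateaued (component F (c + b))"
        using that by (simp_all add: G_def)
      show "4 * (\<Sum>a\<in>UNIV. (T c a)\<^sup>2) < (2 ^ CARD('n))\<^sup>2"
        unfolding parseval using m4 N0 by (simp add: power2_eq_square flip: N_def)
    qed
    then show ?thesis unfolding parseval by (simp add: power2_eq_square mult.assoc flip: N_def)
  qed
  have cardU: "real (card U) = N - 2"
  proof -
    have "card {0, b} \<le> CARD(bit ^ 'n)" by (intro card_mono) auto
    then show ?thesis using b by (simp add: U_def card_Diff_subset of_nat_diff N_def)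
  qed
  define B where "B = real (card (U - G))"
  have GU: "G \<subseteq> U" by (auto simp: G_def)
  have cardG: "real (card G) = N - 2 - B"
    using card_mono[OF _ GU] GU by (simp add: B_def card_Diff_subset of_nat_diff cardU)
  have "card (U - G) \<le> card ((Q - {b}) \<union> (\<lambda>c. c + b) ` (Q - {b}))"
  proof (rule card_mono)
    show "U - G \<subseteq> (Q - {b}) \<union> (\<lambda>c. c + b) ` (Q - {b})"
    proof
      fix c assume c: "c \<in> U - G"
      have "c + b \<noteq> 0" "c + b \<noteq> b" "c \<noteq> 0" "c \<noteq> b" using c by (auto simp: U_def vec_add_eq_0_iff)
      then have "c \<in> Q - {b} \<or> c + b \<in> Q - {b}"
        using c by (auto simp: U_def G_def Q_def)
      moreover have "c = (c + b) + b" by (simp only: add.assoc vec_add_self add_0_right)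
      ultimately show "c \<in> (Q - {b}) \<union> (\<lambda>c. c + b) ` (Q - {b})"
        by blast
    qed
  qed simp
  also have "\<dots> \<le> card (Q - {b}) + card (Q - {b})"
    by (meson add_left_mono card_Un_le card_image_le finite le_trans)
  finally have "B \<le> 2 * real (card (Q - {b}))" by (simp add: B_def)
  also have "real (card (Q - {b})) = real (card Q) - 1"
    using card.remove[OF finite bQ] by linarith
  also have "2 * \<dots> \<le> 2 * ((4 * C - C\<^sup>2 - 1) / 4 * N)"
    using q unfolding Q_def[symmetric] N_def[symmetric] diff_le_eq[symmetric]
    by (rule mult_left_mono) simp
  finally have B_le: "B \<le> 2 * ((4 * C - C\<^sup>2 - 1) / 4 * N)" .
  have "2 * m ^ 4 + real (card G) * (N\<^sup>2 * m) + B * (N * m\<^sup>2)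
      \<le> M 0 + M b + (\<Sum>c\<in>G. M c) + (\<Sum>c\<in>U - G. M c)"
  proof -
    have "real (card G) * (N\<^sup>2 * m) \<le> (\<Sum>c\<in>G. M c)"
      using M_good by (intro sum_bounded_below) auto
    moreover have "B * (N * m\<^sup>2) \<le> (\<Sum>c\<in>U - G. M c)"
      unfolding B_def using M_all by (intro sum_bounded_below) auto
    ultimately show ?thesis using M0 Mb by simp
  qed
  also have "\<dots> = (\<Sum>c\<in>UNIV. M c)"
  proof -
    have "(\<Sum>c\<in>UNIV. M c) = (\<Sum>c\<in>UNIV - {0, b}. M c) + (\<Sum>c\<in>{0, b}. M c)"
      by (rule sum.subset_diff) auto
    moreover have "(\<Sum>c\<in>U. M c) = (\<Sum>c\<in>U - G. M c) + (\<Sum>c\<in>G. M c)"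
      by (rule sum.subset_diff[OF GU]) auto
    ultimately show ?thesis using b by (simp add: U_def)
  qed
  also have "\<dots> \<le> N\<^sup>2 * (3 * m\<^sup>2 - 2 * m)"
    using apn_fourth_moment[OF assms(1), of S] by (simp add: M_def T_def m_def N_def)
  \<comment> \<open>The difference of the two sides of the moment inequality has the
    factor \<open>m * (N - m)\<close>, which is positive.\<close>
  finally have "m * ((N - m) * (N\<^sup>2 - 2 * m * N - 2 * m\<^sup>2)) \<le> m * ((N - m) * (B * N))"
    unfolding cardG by (simp add: power2_eq_square power4_eq_xxxx algebra_simps)
  then have "N\<^sup>2 - 2 * m * N - 2 * m\<^sup>2 \<le> B * N"
    using m0 m4 by (simp add: mult_le_cancel_left_pos)
  also have "B * N \<le> 2 * ((4 * C - C\<^sup>2 - 1) / 4 * N) * N"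
    using B_le N0 by (intro mult_right_mono) auto
  also have "\<dots> = C * N * N - (N - C * N)\<^sup>2 / 2"
    by (simp add: power2_eq_square field_simps)
  finally have "L * N - (N - L)\<^sup>2 / 2 \<le> C * N * N - (N - C * N)\<^sup>2 / 2"
    by (simp add: m power2_eq_square field_simps)
  moreover have "C * N * N < L * N" using L N0 by simp
  moreover have "(N - L)\<^sup>2 \<le> (N - C * N)\<^sup>2" using L LN by (intro power_mono) auto
  ultimately show False by simp
qed

theorem theorem1p3:
  fixes F :: "bit ^ 'n \<Rightarrow> bit ^ 'n" and n q :: nat and N :: real
  assumes "n = CARD('n)" and "n \<ge> 4" and "N = 2 ^ n"
    and "apn F"
    and "q = card {b. b \<noteq> 0 \<and> \<not> plateaued (component F b)}"
  shows "(odd n \<and> q > 0 \<longrightarrow> (linearity F)\<^sup>2 \<le> N * (1 + sqrt (real q * (N - 1)))) \<and>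
         (even n \<longrightarrow> (\<forall>C::real. 1/2 \<le> C \<and> C < 1 \<longrightarrow>
            real q \<le> (4 * C - C\<^sup>2 - 1) / 4 * N + 1 \<longrightarrow> linearity F \<le> C * N))"
  using linearity_bound_odd[OF assms(4) _ assms(5)] linearity_bound_even[OF assms(4)] assms(1-3)
  unfolding assms(5) by auto

end
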